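(* Let $\to$ be a partial preorder (a reflexive and transitive relation) on a set $X$. Let $\Gamma$ be the simple undirected graph with vertex set $X$ in which two distinct elements $x,y\in X$ are adjacent if and only if $x\to y$ or $y\to x$. Then $\Gamma$ is a perfect graph, that is, all its induced subgraphs have clique number equal to chromatic number.
   Context: The graph $\Gamma$ is obtained from the directed graph on $X$ whose arcs are the pairs $(x,y)$ with $x\to y$ and $x\ne y$, by ignoring directions and placing a single edge $\{x,y\}$ if both $x\to y$ and $y\to x$. The motivating case: if $M$ is a transformation monoid on $X$ (a collection of maps $X\to X$ closed under composition and containing the identity map), then the rule that $x\to y$ if and only if some element of $M$ maps $x$ to $y$ defines a partial preorder on $X$; the endomorphism graph of a group is the case where $X$ is the set of elements of the group and $M$ is its endomorphism monoid. *)

theory Defs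
  imports "HOL-Library.Ramsey" "HOL-Library.Extended_Nat"
begin

record 'a graph =
  verts :: "'a set"
  edges :: "'a set set"

definition simple_graph :: "'a graph \<Rightarrow> bool" where
  "simple_graph G \<longleftrightarrow> edges G \<subseteq> {e. e \<subseteq> verts G \<and> card e = 2}"

definition induced_subgraph :: "'a graph \<Rightarrow> 'a set \<Rightarrow> 'a graph" where
  "induced_subgraph G W = \<lparr>verts = W, edges = {e \<in> edges G. e \<subseteq> W}\<rparr>"

text \<open>
  Graphs may be infinite. The clique number and the chromatic number take values in
  \<^typ>\<open>enat\<close>: the clique number is \<open>\<infinity>\<close> iff there are arbitrarily large finite cliques, the
  chromatic number is \<open>\<infinity>\<close> iff no proper colouring uses finitely many colours. Infinite
  cardinals are deliberately not distinguished: there are comparability graphs all of whose cliques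
  are countable but which have no proper colouring with countably many colours.
\<close>

definition clique_number :: "'a graph \<Rightarrow> enat" where
  "clique_number G = (SUP K \<in> {K. K \<subseteq> verts G \<and> finite K \<and> clique K (edges G)}. enat (card K))"

definition proper_colouring :: "'a graph \<Rightarrow> nat \<Rightarrow> ('a \<Rightarrow> nat) \<Rightarrow> bool" where
  "proper_colouring G k c \<longleftrightarrow>
     c ` verts G \<subseteq> {..<k} \<and>
     (\<forall>x \<in> verts G. \<forall>y \<in> verts G. {x, y} \<in> edges G \<longrightarrow> c x \<noteq> c y)"

definition chromatic_number :: "'a graph \<Rightarrow> enat" where
  "chromatic_number G = (INF k \<in> {k. \<exists>c. proper_colouring G k c}. enat k)"

definition perfect_graph :: "'a graph \<Rightarrow> bool" where
  "perfect_graph G \<longleftrightarrow>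
     (\<forall>W \<subseteq> verts G.
        clique_number (induced_subgraph G W) = chromatic_number (induced_subgraph G W))"

definition comparability_graph :: "'a set \<Rightarrow> 'a rel \<Rightarrow> 'a graph" where
  "comparability_graph X r =
     \<lparr>verts = X,
      edges = {{x, y} | x y. x \<in> X \<and> y \<in> X \<and> x \<noteq> y \<and> ((x, y) \<in> r \<or> (y, x) \<in> r)}\<rparr>"

lemma simple_graph_comparability_graph: "simple_graph (comparability_graph X r)"
  by (auto simp: simple_graph_def comparability_graph_def)

lemma comparability_graph_adjacent_iff:
  "{x, y} \<in> edges (comparability_graph X r) \<longleftrightarrow>
     x \<in> X \<and> y \<in> X \<and> x \<noteq> y \<and> ((x, y) \<in> r \<or> (y, x) \<in> r)"
  by (auto simp: comparability_graph_def doubleton_eq_iff)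

end

theory Submission
  imports Defs
begin

text \<open>
  The reason is Mirsky's theorem, the dual of Dilworth's: colour each vertex by its
  height, the number of elements strictly below it in a longest chain that it tops. Since a preorder
  can have many elements equivalent to one another, heights are taken in a strict partial order with
  the same comparable pairs, which \<open>preorder_strict_orientation\<close> obtains by breaking ties inside each
  equivalence class along a linear order. Adjacency then means strict comparability, so heights differ
  along every edge, and a bound \<open>n\<close> on the sizes of the finite cliques confines the heights to
  \<open>{..<n}\<close> (\<open>height_colouring\<close>). The same strict order
  serves every induced subgraph. If cliques are unbounded, both numbers are \<open>\<infinity>\<close>, as a
  clique needs pairwise distinct colours (\<open>clique_number_le_chromatic_number\<close>).
\<close>

text \<open>
  A proper colouring is injective on every clique.
\<close>
lemma clique_number_le_chromatic_number: "clique_number G \<le> chromatic_number G"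
  unfolding clique_number_def chromatic_number_def
proof (intro SUP_least INF_greatest)
  fix K k
  assume "K \<in> {K. K \<subseteq> verts G \<and> finite K \<and> clique K (edges G)}"
    and "k \<in> {k. \<exists>c. proper_colouring G k c}"
  then obtain c where K: "K \<subseteq> verts G" "clique K (edges G)" and c: "proper_colouring G k c"
    by blast
  have "inj_on c K"
    using K c unfolding inj_on_def clique_def proper_colouring_def by (meson subsetD)
  moreover have "c ` K \<subseteq> {..<k}"
    using K c unfolding proper_colouring_def by blast
  ultimately have "card K \<le> card {..<k}"
    by (rule card_inj_on_le) simp
  then show "enat (card K) \<le> enat k" by simp
qed

text \<open>
  Between inequivalent elements the direction is that of the preorder; inside an equivalence class
  it is borrowed from an arbitrary linear order, here a well-order of the type.
\<close>
lemma preorder_strict_orientation: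
  assumes "preorder_on X r"
  obtains s where "trans s" "irrefl s"
    "\<And>x y. (x, y) \<in> s \<or> (y, x) \<in> s \<longleftrightarrow> x \<noteq> y \<and> ((x, y) \<in> r \<or> (y, x) \<in> r)"
proof -
  have tr: "trans r" using assms by (simp add: preorder_on_def)
  obtain w :: "'a rel" where "well_order_on UNIV w" using well_order_on by blast
  then have w: "trans w" "antisym w" "total w"
    by (auto simp: order_on_defs)
  define s where "s = {(x, y). (x, y) \<in> r \<and> ((y, x) \<in> r \<longrightarrow> x \<noteq> y \<and> (x, y) \<in> w)}"
  show thesis
  proof
    show "trans s"
    proof (rule transI)
      fix x y z
      assume xy: "(x, y) \<in> s" and yz: "(y, z) \<in> s"
      then have xz: "(x, z) \<in> r"
        using transD[OF tr, of x y z] unfolding s_def by blast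
      have "x \<noteq> z \<and> (x, z) \<in> w" if zx: "(z, x) \<in> r"
      proof -
        \<comment> \<open>The cycle makes the three elements equivalent, so both steps were decided by \<open>w\<close>.\<close>
        have "(y, x) \<in> r" "(z, y) \<in> r"
          using xy yz zx transD[OF tr, of y z x] transD[OF tr, of z x y] unfolding s_def by blast+
        then show ?thesis
          using xy yz transD[OF w(1), of x y z] antisymD[OF w(2), of x y] unfolding s_def by blast
      qed
      with xz show "(x, z) \<in> s" unfolding s_def by simp
    qed
    show "irrefl s" by (auto simp: irrefl_def s_def)
    show "(x, y) \<in> s \<or> (y, x) \<in> s \<longleftrightarrow> x \<noteq> y \<and> ((x, y) \<in> r \<or> (y, x) \<in> r)" for x y
      using w(3) unfolding s_def total_on_def by auto
  qed
qed

text \<open>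
  Mirsky's argument for a possibly infinite order with bounded chains. The colour of a vertex \<open>x\<close> is
  the largest size of a clique all of whose other members lie below \<open>x\<close>, with \<open>x\<close> itself left out of
  the count so that colours start at \<open>0\<close>; going up one step extends such a clique.
\<close>
lemma height_colouring:
  assumes "trans s" "irrefl s"
    and edges: "\<And>x y. x \<in> verts G \<Longrightarrow> y \<in> verts G \<Longrightarrow>
      {x, y} \<in> edges G \<longleftrightarrow> (x, y) \<in> s \<or> (y, x) \<in> s"
    and bound: "\<And>K. K \<subseteq> verts G \<Longrightarrow> finite K \<Longrightarrow> clique K (edges G) \<Longrightarrow> card K \<le> n"
  shows "\<exists>c. proper_colouring G n c"
proof -
  define B where "B x = {K. K \<subseteq> verts G \<and> finite K \<and> clique K (edges G) \<and>
    x \<notin> K \<and> (\<forall>z\<in>K. (z, x) \<in> s)}" for x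
  define h where "h x = Max (card ` B x)" for x
  have extend: "insert x K \<subseteq> verts G \<and> finite (insert x K) \<and> clique (insert x K) (edges G)
      \<and> card (insert x K) = Suc (card K)"
    if "x \<in> verts G" "K \<in> B x" for x K
  proof -
    have K: "K \<subseteq> verts G" "finite K" "clique K (edges G)" "x \<notin> K" "\<forall>z\<in>K. (z, x) \<in> s"
      using that(2) unfolding B_def by auto
    have "{x, z} \<in> edges G \<and> {z, x} \<in> edges G" if "z \<in> K" for z
      using edges \<open>x \<in> verts G\<close> K that by blast
    then have "clique (insert x K) (edges G)"
      using K(3) unfolding clique_def by blast
    with K \<open>x \<in> verts G\<close> show ?thesis by simp
  qed
  have small: "Suc (card K) \<le> n" if "x \<in> verts G" "K \<in> B x" for x K
    using extend[OF that] bound by metis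
  have fin: "finite (card ` B x)" if "x \<in> verts G" for x
  proof (rule finite_subset)
    show "card ` B x \<subseteq> {..n}" using small[OF that] Suc_leD by blast
  qed simp
  have ne: "{} \<in> B x" for x
    unfolding B_def clique_def by simp
  have attained: "\<exists>K\<in>B x. card K = h x" if "x \<in> verts G" for x
  proof -
    have "h x \<in> card ` B x"
      unfolding h_def using fin[OF that] ne[of x] by (intro Max_in) blast+
    then show ?thesis by (metis imageE)
  qed
  have less: "h x < h y" if xy: "x \<in> verts G" "y \<in> verts G" "(x, y) \<in> s" for x y
  proof -
    obtain K where K: "K \<in> B x" "card K = h x" using attained xy(1) by blast
    have below: "\<forall>z\<in>insert x K. (z, y) \<in> s"
      using K(1) xy(3) transD[OF assms(1), of _ x y] unfolding B_def by blast
    then have "y \<notin> insert x K" using assms(2) unfolding irrefl_def by blast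
    then have "insert x K \<in> B y"
      unfolding B_def using below extend[OF xy(1) K(1)] by (intro CollectI conjI) simp_all
    then have "card (insert x K) \<le> h y"
      unfolding h_def by (intro Max_ge fin[OF xy(2)] imageI)
    with extend[OF xy(1) K(1)] K(2) show ?thesis by simp
  qed
  have "proper_colouring G n h"
    unfolding proper_colouring_def
  proof (intro conjI ballI impI)
    show "h ` verts G \<subseteq> {..<n}"
      using attained small Suc_le_eq by (metis image_subsetI lessThan_iff)
    show "h x \<noteq> h y" if "x \<in> verts G" "y \<in> verts G" "{x, y} \<in> edges G" for x y
    proof -
      have "(x, y) \<in> s \<or> (y, x) \<in> s" using edges[OF that(1,2)] that(3) by blast
      then show ?thesis using less[OF that(1,2)] less[OF that(2,1)] by linarith
    qed
  qed
  then show ?thesis by blast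
qed

theorem mainTheorem1:
  fixes X :: "'a set" and r :: "'a rel"
  assumes "preorder_on X r"
  shows "perfect_graph (comparability_graph X r)"
proof -
  obtain s where s: "trans s" "irrefl s"
    "\<And>x y. (x, y) \<in> s \<or> (y, x) \<in> s \<longleftrightarrow> x \<noteq> y \<and> ((x, y) \<in> r \<or> (y, x) \<in> r)"
    using preorder_strict_orientation[OF assms] by blast
  have "clique_number (induced_subgraph (comparability_graph X r) W)
      = chromatic_number (induced_subgraph (comparability_graph X r) W)" (is "clique_number ?G = _")
    if W: "W \<subseteq> X" for W
  proof (cases "clique_number ?G")
    case (enat n)
    have edges: "{x, y} \<in> edges ?G \<longleftrightarrow> (x, y) \<in> s \<or> (y, x) \<in> s"
      if "x \<in> verts ?G" "y \<in> verts ?G" for x y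
      using that W s(3)
      by (auto simp: induced_subgraph_def comparability_graph_adjacent_iff)
    have bound: "card K \<le> n" if "K \<subseteq> verts ?G" "finite K" "clique K (edges ?G)" for K
    proof -
      have "enat (card K) \<le> clique_number ?G"
        unfolding clique_number_def by (rule SUP_upper) (use that in blast)
      with enat show ?thesis by simp
    qed
    obtain c where "proper_colouring ?G n c"
      using height_colouring[OF s(1,2) edges bound] by blast
    then have "chromatic_number ?G \<le> enat n"
      unfolding chromatic_number_def by (blast intro: INF_lower)
    with enat show ?thesis
      using clique_number_le_chromatic_number[of ?G] by simp
  next
    case infinity
    with clique_number_le_chromatic_number[of ?G] show ?thesis by simp
  qed
  then show ?thesis
    by (simp add: perfect_graph_def comparability_graph_def)
qed

end
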